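(* Consider the partial backorder inventory system with positive lead time $\tau\ge1$. Assume that $\mathbb{E}D_1>0$ and that $\mathbb{E}e^{\gamma D_1}<\infty$ for some $\gamma>0$. Then for any initial state ${\bf x}$, $$\frac{\max_{s}\mathcal{C}^s(r,h;{\bf x})}{\max_{\pi\in\mathcal{A}}\mathcal{C}^\pi(r,h;{\bf x})}\longrightarrow 1\qquad\text{as } r\to\infty,$$ where $\mathcal{C}^s(r,h;{\bf x})$ is the long-run average profit under the base-stock policy with level $s$.
   Context: Notation: $x^+=\max\{x,0\}$, $x\wedge y=\min(x,y)$, $a_{[i,k]}=\sum_{j=i}^k a_j$ (equal to $0$ if $i>k$). Partial backorder system. The lead time is a fixed integer $\tau\ge1$, the patience parameter is $p\in[0,1]$, the sale price per unit is $r>0$ and the holding cost per unit per period is $h>0$. Demands $D_1,D_2,\dots$ are i.i.d. nonnegative integer-valued with finite mean $d$. For each period $i$, $\{\xi_{i;\ell}:\ell\ge1\}$ are i.i.d. Bernoulli random variables with mean $p$; these families are independent over $i$ and independent of the demands. The state at the beginning of period $i$ is $X_i=(I_i,B_{i-1},Q_{i-\tau},\dots,Q_{i-1})$ (on-hand inventory, backorders, outstanding orders), nonnegative integers with $I_iB_{i-1}=0$. In period $i$: the order $Q_{i-\tau}$ arrives; an order quantity $Q_i\in\{0,1,2,\dots\}$ is chosen depending on $X_i$ (it is delivered at the start of period $i+\tau$); demand $D_i$ is realized; the unmet demand is $U_i=(B_{i-1}+D_i-I_i-Q_{i-\tau})^+$ and $I_{i+1}=(I_i+Q_{i-\tau}-B_{i-1}-D_i)^+$;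 $B_i=\xi_{i;[1,U_i]}$ is backordered and $L_i=U_i-B_i$ is lost. A sequence $\pi=(Q_1,Q_2,\dots)$ of such order quantities is an admissible policy; $\mathcal{A}$ is the set of admissible policies. The long-run average profit under $\pi$ from initial state ${\bf x}$ is $$\mathcal{C}^\pi(r,h;{\bf x})=\liminf_{N\to\infty}\frac1N\mathbb{E}\Big[\sum_{i=1}^N \Big(r\cdot\big((I_i+Q_{i-\tau})\wedge(B_{i-1}+D_i)\big)-h\cdot(I_i+Q_{i-\tau}-B_{i-1}-D_i)^+\Big)\Big|X_1={\bf x}\Big].$$ The base-stock policy with level $s$ ($s$ a nonnegative integer) orders $Q_i=(s-IP_i)^+$ where $IP_i=I_i+Q_{[i-\tau,i-1]}-B_{i-1}$ is the inventory position. *)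

theory Defs
  imports "HOL-Probability.Probability"
begin

text \<open>
  A state \<open>(I, B, qs)\<close> at the beginning of period \<open>i\<close> consists of the on-hand inventory \<open>I\<^sub>i\<close>, the
  backorders \<open>B\<close> left from period \<open>i - 1\<close>, and the outstanding orders, oldest first. The lead time
  is the length of the list, so its head is the order arriving in period \<open>i\<close>.
\<close>

type_synonym state = "nat \<times> nat \<times> nat list"

definition valid_state :: "nat \<Rightarrow> state \<Rightarrow> bool" where
  "valid_state \<tau> = (\<lambda>(I, B, qs). I * B = 0 \<and> length qs = \<tau>)"

text \<open>
  The order placed in period \<open>i\<close> is \<open>\<pi> i x\<close>, where \<open>x\<close> is the state at the beginning of that period.
  Every function of this type is an admissible policy.
\<close>

type_synonym policy = "nat \<Rightarrow> state \<Rightarrow> nat"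

definition inventory_position :: "state \<Rightarrow> int" where
  "inventory_position = (\<lambda>(I, B, qs). int I + int (sum_list qs) - int B)"

definition base_stock :: "nat \<Rightarrow> policy" where
  "base_stock s = (\<lambda>i x. nat (int s - inventory_position x))"

text \<open>
  One period with order quantity \<open>q\<close> and demand \<open>d\<close>; \<open>\<xi> l\<close> says whether the \<open>l\<close>-th unit of unmet
  demand is backordered. Truncated subtraction of natural numbers is the positive part.
\<close>

definition step :: "nat \<Rightarrow> nat \<Rightarrow> (nat \<Rightarrow> bool) \<Rightarrow> state \<Rightarrow> state" where
  "step q d \<xi> = (\<lambda>(I, B, qs).
     let U = (B + d) - (I + hd qs)
     in ((I + hd qs) - (B + d), (\<Sum>l = 1..U. of_bool (\<xi> l)), tl qs @ [q]))"

definition period_profit :: "real \<Rightarrow> real \<Rightarrow> nat \<Rightarrow> state \<Rightarrow> real" where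
  "period_profit r h d = (\<lambda>(I, B, qs).
     r * real (min (I + hd qs) (B + d)) - h * real ((I + hd qs) - (B + d)))"

text \<open>
  \<open>state_after \<pi> D \<xi> x n\<close> is the state after the first \<open>n\<close> periods, that is, at the beginning of
  period \<open>n + 1\<close>, along the demand path \<open>D\<close> and the patience marks \<open>\<xi>\<close>. Periods are numbered from 1.
\<close>

primrec state_after ::
    "policy \<Rightarrow> (nat \<Rightarrow> nat) \<Rightarrow> (nat \<Rightarrow> nat \<Rightarrow> bool) \<Rightarrow> state \<Rightarrow> nat \<Rightarrow> state" where
  "state_after \<pi> D \<xi> x 0 = x"
| "state_after \<pi> D \<xi> x (Suc n) =
     (let y = state_after \<pi> D \<xi> x n in step (\<pi> (Suc n) y) (D (Suc n)) (\<xi> (Suc n)) y)"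

definition total_profit ::
    "real \<Rightarrow> real \<Rightarrow> policy \<Rightarrow> (nat \<Rightarrow> nat) \<Rightarrow> (nat \<Rightarrow> nat \<Rightarrow> bool) \<Rightarrow> state \<Rightarrow> nat \<Rightarrow> real" where
  "total_profit r h \<pi> D \<xi> x N =
     (\<Sum>i = 1..N. period_profit r h (D i) (state_after \<pi> D \<xi> x (i - 1)))"

text \<open>
  Expectation with values in the extended reals. A policy may order so much that its expected
  holding cost is infinite; its expected profit is then \<open>-\<infinity>\<close>, whereas the Bochner integral would
  be 0. The positive part of the profit over \<open>N\<close> periods is at most \<open>r\<close> times the initial backorders
  plus total demand, so the difference is never of the form \<open>\<infinity> - \<infinity>\<close> when demand has finite mean.
\<close>

definition ext_expectation :: "'w measure \<Rightarrow> ('w \<Rightarrow> real) \<Rightarrow> ereal" where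
  "ext_expectation M f =
     enn2ereal (\<integral>\<^sup>+ w. ennreal (f w) \<partial>M) - enn2ereal (\<integral>\<^sup>+ w. ennreal (- f w) \<partial>M)"

text \<open>
  Conditioning on the state in period 1 being \<open>x\<close> is rendered by starting the recursion in \<open>x\<close>:
  the demands and patience marks carry no further dependence on that state.
\<close>

definition avg_profit ::
    "'w measure \<Rightarrow> (nat \<Rightarrow> 'w \<Rightarrow> nat) \<Rightarrow> (nat \<Rightarrow> nat \<Rightarrow> 'w \<Rightarrow> bool) \<Rightarrow> real \<Rightarrow> real \<Rightarrow> policy \<Rightarrow> state \<Rightarrow> ereal"
    where
  "avg_profit M D \<xi> r h \<pi> x =
     liminf (\<lambda>N. ext_expectation M
               (\<lambda>w. total_profit r h \<pi> (\<lambda>i. D i w) (\<lambda>i l. \<xi> i l w) x N) / ereal (real N))"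

end

theory Submission
  imports Defs
begin

text \<open>
  Sold units are part of the initial backorders or of the demand, so no policy earns more than
  \<open>r\<close> times the mean demand \<open>\<mu>\<close>. It therefore suffices to find, for each \<open>\<epsilon>\<close>, one fixed base-stock level
  that sells at rate at least \<open>\<mu> - \<epsilon>\<close> at a holding cost that does not depend on \<open>r\<close>. After ordering, the
  inventory position is at least \<open>s\<close>, so the unmet demand of period \<open>n\<close> is at most the positive part of
  the demand of periods \<open>n - \<tau>, \<dots>, n\<close> minus \<open>s\<close>, whose mean vanishes as \<open>s\<close> grows. The holding cost
  needs more care: backorders that are lost later push the inventory position above \<open>s\<close>. This excess
  is dominated by a reflected random walk with negative drift, whose mean is bounded on average by a
  quadratic Lyapunov argument.
\<close>

section \<open>One-period dynamics of stock, pipeline and backorders\<close>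

definition unmet :: "nat \<Rightarrow> state \<Rightarrow> nat" where
  "unmet d = (\<lambda>(I, B, qs). (B + d) - (I + hd qs))"

text \<open>Interpolates between the net inventory (\<open>k = 0\<close>), the net stock facing the
  current demand before it is subtracted (\<open>k = 1\<close>), and the inventory position
  (\<open>k\<close> the whole pipeline). It is integer valued because backorders can exceed the
  counted stock.\<close>

definition near_position :: "nat \<Rightarrow> state \<Rightarrow> int" where
  "near_position k = (\<lambda>(I, B, qs). int I + int (sum_list (take k qs)) - int B)"

definition pipeline_length :: "state \<Rightarrow> nat" where
  "pipeline_length = (\<lambda>(I, B, qs). length qs)"

lemma sum_of_bool_le: "(\<Sum>l = 1..U. of_bool (\<xi> l)) \<le> (U::nat)"
proof -
  have "(\<Sum>l = 1..U. of_bool (\<xi> l)) \<le> (\<Sum>l = 1..U. 1::nat)"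
    by (intro sum_mono) auto
  then show ?thesis by simp
qed

lemma pipeline_length_step:
  assumes "pipeline_length y > 0"
  shows "pipeline_length (step q d \<xi> y) = pipeline_length y"
  using assms by (auto simp: pipeline_length_def step_def Let_def split: prod.splits)

text \<open>The oldest order arrives and becomes stock, so \<open>Suc k\<close> counted orders turn
  into \<open>k\<close>; since \<open>k\<close> is below the pipeline length, the new order
  \<open>q\<close> is not counted. Demand is the only decrease, and it is an inequality because lost
  units need not be served later.\<close>

lemma near_position_step:
  assumes "k < pipeline_length y"
  shows "near_position k (step q d \<xi> y) \<ge> near_position (Suc k) y - int d"
proof -
  obtain I B qs where y: "y = (I, B, qs)" by (cases y)
  obtain a as where qs: "qs = a # as" and "k \<le> length as"
    using assms y by (cases qs) (auto simp: pipeline_length_def)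
  then show ?thesis
    using sum_of_bool_le[of "\<xi>" "B + d - (I + a)"]
    by (simp add: y qs near_position_def step_def Let_def)
qed

lemma inventory_position_eq_near_position:
  "inventory_position y = near_position (pipeline_length y) y"
  by (auto simp: inventory_position_def near_position_def pipeline_length_def split: prod.splits)

text \<open>The position changes by exactly \<open>q - d\<close> plus the number of lost units,
  which lies between 0 and the unmet demand. On-hand stock exceeds the position at most by the new
  backorders, again at most the unmet demand.\<close>

lemma inventory_position_step:
  assumes "pipeline_length y > 0"
  shows "inventory_position (step q d \<xi> y) \<ge> inventory_position y + int q - int d"
    and "inventory_position (step q d \<xi> y) \<le> inventory_position y + int q - int d + int (unmet d y)"
    and "int (fst (step q d \<xi> y)) \<le> inventory_position (step q d \<xi> y) + int (unmet d y)"
proof -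
  obtain I B qs where y: "y = (I, B, qs)" by (cases y)
  obtain a as where qs: "qs = a # as"
    using assms y by (cases qs) (auto simp: pipeline_length_def)
  note * = y qs inventory_position_def step_def unmet_def Let_def
  show "inventory_position (step q d \<xi> y) \<ge> inventory_position y + int q - int d"
    using sum_of_bool_le[of "\<xi>" "B + d - (I + a)"]
    by (simp add: *)
  show "inventory_position (step q d \<xi> y) \<le> inventory_position y + int q - int d + int (unmet d y)"
    by (simp add: *)
  show "int (fst (step q d \<xi> y)) \<le> inventory_position (step q d \<xi> y) + int (unmet d y)"
    using sum_of_bool_le[of "\<xi>" "B + d - (I + a)"]
    by (simp add: *) 
qed

lemma unmet_near_position:
  assumes "pipeline_length y > 0"
  shows "int (unmet d y) = max 0 (int d - near_position 1 y)"
proof -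
  obtain I B qs where y: "y = (I, B, qs)" by (cases y)
  obtain a as where qs: "qs = a # as"
    using assms y by (cases qs) (auto simp: pipeline_length_def)
  show ?thesis by (simp add: y qs unmet_def near_position_def)
qed

lemma near_position_Suc_ge: "near_position k y \<le> near_position (Suc k) y"
proof -
  obtain I B qs where y: "y = (I, B, qs)" by (cases y)
  show ?thesis by (cases "k < length qs") (auto simp: y near_position_def take_Suc_conv_app_nth)
qed

lemma inventory_position_base_stock:
  "inventory_position y + int (base_stock s i y) = max (int s) (inventory_position y)"
  by (auto simp: base_stock_def)

text \<open>Sales are the demand to be served minus its unmet part. Both \<open>q\<close> and
  \<open>\<xi>\<close> are arbitrary because the on-hand stock after the period depends on
  neither.\<close>

lemma period_profit_eq:
  "period_profit r h d y = r * (real (fst (snd y)) + real d - real (unmet d y)) - h * real (fst (step q d \<xi> y))"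
  by (cases y) (auto simp: period_profit_def unmet_def step_def Let_def min_def)

lemma snd_step_le_unmet: "fst (snd (step q d \<xi> y)) \<le> unmet d y"
  using sum_of_bool_le by (auto simp: step_def unmet_def Let_def split: prod.splits)

lemma pipeline_length_state_after:
  assumes "pipeline_length x > 0"
  shows "pipeline_length (state_after \<pi> D \<xi> x n) = pipeline_length x"
  using assms by (induction n) (auto simp: Let_def pipeline_length_step)

section \<open>Pathwise upper bound for every policy\<close>

lemma total_profit_le:
  assumes "r \<ge> 0" "h \<ge> 0"
  shows "total_profit r h \<pi> D \<xi> x N \<le> r * (real (fst (snd x)) + (\<Sum>i = 1..N. real (D i)))"
proof -
  let ?y = "state_after \<pi> D \<xi> x"
  \<comment> \<open>The induction carries the value of the current backorders along: they are units
    that may still be sold, and without this term they would be counted again in the next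
    period.\<close>
  have "total_profit r h \<pi> D \<xi> x N + r * real (fst (snd (?y N)))
      \<le> r * (real (fst (snd x)) + (\<Sum>i = 1..N. real (D i)))"
  proof (induction N)
    case (Suc N)
    let ?B = "\<lambda>n. real (fst (snd (?y n)))"
    let ?d = "D (Suc N)"
    have "period_profit r h ?d (?y N) \<le> r * (?B N + real ?d - real (unmet ?d (?y N)))"
      using assms by (simp add: period_profit_eq[where q = 0 and \<xi> = "\<lambda>_. True"])
    moreover have "r * ?B (Suc N) \<le> r * real (unmet ?d (?y N))"
      using assms snd_step_le_unmet by (intro mult_left_mono) (simp_all add: Let_def)
    ultimately have "period_profit r h ?d (?y N) + r * ?B (Suc N) \<le> r * (?B N + real ?d)"
      by (simp add: algebra_simps)
    with Suc show ?case
      by (simp add: total_profit_def algebra_simps)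
  qed (simp add: total_profit_def)
  moreover have "0 \<le> r * real (fst (snd (?y N)))" using assms by simp
  ultimately show ?thesis by linarith
qed

section \<open>Pathwise lower bound for base-stock policies\<close>

text \<open>
  Shares \<open>shortage k\<close> whose sum over the periods \<open>n - \<tau>, \<dots>, n\<close> bounds the unmet demand of period \<open>n\<close>
  under the base-stock level \<open>(\<tau> + 1) * c\<close>. Period 0 carries the initial backorders \<open>b\<close>; the demand of the
  first \<open>\<tau>\<close> periods enters in full because the initial pipeline is not controlled by the policy.
\<close>

definition shortage :: "nat \<Rightarrow> nat \<Rightarrow> nat \<Rightarrow> (nat \<Rightarrow> nat) \<Rightarrow> nat \<Rightarrow> nat" where
  "shortage \<tau> c b D k = (if k = 0 then b else if k \<le> \<tau> then D k else D k - c)"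

definition unmet_bound :: "nat \<Rightarrow> nat \<Rightarrow> nat \<Rightarrow> (nat \<Rightarrow> nat) \<Rightarrow> nat \<Rightarrow> nat" where
  "unmet_bound \<tau> c b D n = (\<Sum>k = n - \<tau>..n. shortage \<tau> c b D k)"

text \<open>
  \<open>k + \<tau> - n\<close> (truncated) is the number of periods after \<open>n\<close> whose unmet demand is still charged with
  the share of period \<open>k\<close>.
\<close>

definition pending :: "nat \<Rightarrow> nat \<Rightarrow> nat \<Rightarrow> (nat \<Rightarrow> nat) \<Rightarrow> nat \<Rightarrow> nat" where
  "pending \<tau> c b D n = (\<Sum>k\<le>n. (k + \<tau> - n) * shortage \<tau> c b D k)"

text \<open>The share of period \<open>k\<close> is charged once in each of the periods
  \<open>k, ..., k + \<tau>\<close>. Moving to period \<open>Suc n\<close> uses up one charge of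
  every share in the window, in total \<open>unmet_bound\<close> there, while the new share enters
  with all its \<open>\<tau> + 1\<close> charges.\<close>

lemma pending_Suc:
  "pending \<tau> c b D (Suc n) + unmet_bound \<tau> c b D (Suc n)
     = pending \<tau> c b D n + (\<tau> + 1) * shortage \<tau> c b D (Suc n)"
proof -
  let ?e = "shortage \<tau> c b D"
  have "unmet_bound \<tau> c b D (Suc n) = (\<Sum>k\<le>Suc n. if Suc n - \<tau> \<le> k then ?e k else 0)"
    unfolding unmet_bound_def by (rule sum.mono_neutral_cong_left) auto
  then have "pending \<tau> c b D (Suc n) + unmet_bound \<tau> c b D (Suc n)
     = (\<Sum>k\<le>Suc n. (k + \<tau> - Suc n) * ?e k + (if Suc n - \<tau> \<le> k then ?e k else 0))"
    by (simp add: pending_def sum.distrib)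
  also have "\<dots> = (\<Sum>k\<le>n. (k + \<tau> - Suc n) * ?e k + (if Suc n - \<tau> \<le> k then ?e k else 0))
      + (\<tau> + 1) * ?e (Suc n)"
    by simp
  also have "(\<Sum>k\<le>n. (k + \<tau> - Suc n) * ?e k + (if Suc n - \<tau> \<le> k then ?e k else 0))
      = pending \<tau> c b D n"
    unfolding pending_def
  proof (intro sum.cong refl)
    fix k assume "k \<in> {..n}"
    show "(k + \<tau> - Suc n) * ?e k + (if Suc n - \<tau> \<le> k then ?e k else 0) = (k + \<tau> - n) * ?e k"
    proof (cases "Suc n - \<tau> \<le> k")
      case True
      then have "k + \<tau> - n = Suc (k + \<tau> - Suc n)" by linarith
      then show ?thesis using True by simp
    qed simp
  qed
  finally show ?thesis .
qed

text \<open>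
  Dominates the excess of the inventory position over the base-stock level. Adding the pending shares
  makes the increments depend on the demand of a single period, and the recursion involves only the
  demands, so that its value after \<open>n\<close> periods is independent of the demand of period \<open>n + 1\<close>.
\<close>

primrec excess_bound :: "nat \<Rightarrow> nat \<Rightarrow> nat \<Rightarrow> nat \<Rightarrow> (nat \<Rightarrow> nat) \<Rightarrow> nat \<Rightarrow> real" where
  "excess_bound \<tau> c b v D 0 = real v + real (pending \<tau> c b D 0)"
| "excess_bound \<tau> c b v D (Suc n) =
     max (excess_bound \<tau> c b v D n + ((real \<tau> + 1) * real (shortage \<tau> c b D (Suc n)) - real (D (Suc n))))
         (real (pending \<tau> c b D (Suc n)))"

text \<open>The order of period \<open>Suc m\<close> lifts the inventory position to at least
  \<open>s\<close>. Every later period moves one of the counted orders into stock and leaves newer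
  orders uncounted, so only demand is subtracted; at \<open>j = \<tau> - 1\<close> this bounds the
  stock facing the next demand.\<close>

lemma near_position_base_stock:
  fixes s :: nat and D :: "nat \<Rightarrow> nat" and \<xi> :: "nat \<Rightarrow> nat \<Rightarrow> bool"
  assumes "pipeline_length x = \<tau>" "j < \<tau>"
  defines "y \<equiv> state_after (base_stock s) D \<xi> x"
  shows "near_position (\<tau> - j) (y (Suc m + j)) \<ge> int s - int (\<Sum>k = Suc m..Suc m + j. D k)"
  using \<open>j < \<tau>\<close>
proof (induction j)
  case 0
  have len: "pipeline_length (y n) = \<tau>" for n
    unfolding y_def using assms 0 by (simp add: pipeline_length_state_after)
  have "inventory_position (y (Suc m)) \<ge> inventory_position (y m) + int (base_stock s (Suc m) (y m)) - int (D (Suc m))"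
    using inventory_position_step(1)[of "y m"] len 0 by (simp add: y_def Let_def)
  then show ?case
    using inventory_position_base_stock[of "y m" s "Suc m"] len
    by (simp add: inventory_position_eq_near_position)
next
  case (Suc j)
  have len: "pipeline_length (y n) = \<tau>" for n
    unfolding y_def using assms Suc by (simp add: pipeline_length_state_after)
  have "near_position (\<tau> - Suc j) (y (Suc (Suc m + j))) \<ge> near_position (Suc (\<tau> - Suc j)) (y (Suc m + j)) - int (D (Suc (Suc m + j)))"
  proof -
    have "y (Suc (Suc m + j)) = step (base_stock s (Suc (Suc m + j)) (y (Suc m + j)))
        (D (Suc (Suc m + j))) (\<xi> (Suc (Suc m + j))) (y (Suc m + j))"
      unfolding y_def state_after.simps(2) Let_def ..
    then show ?thesis using near_position_step len Suc.prems by simp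
  qed
  moreover have "Suc (\<tau> - Suc j) = \<tau> - j" using Suc.prems by simp
  ultimately show ?case using Suc by simp
qed

text \<open>Crude bound for the initial phase, in which all arrivals come from the given pipeline:
  every arrival is ignored.\<close>

lemma near_position_0_ge:
  assumes "pipeline_length x > 0"
  shows "near_position 0 (state_after \<pi> D \<xi> x n) \<ge> - int (fst (snd x)) - int (\<Sum>k = 1..n. D k)"
proof (induction n)
  case 0
  show ?case by (auto simp: near_position_def split: prod.splits)
next
  case (Suc n)
  let ?y = "state_after \<pi> D \<xi> x"
  have "near_position 0 (?y (Suc n)) \<ge> near_position (Suc 0) (?y n) - int (D (Suc n))"
    using near_position_step[of 0 "?y n"] assms
    by (simp add: pipeline_length_state_after Let_def)
  then show ?case using Suc near_position_Suc_ge[of 0 "?y n"] by simp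
qed

text \<open>For \<open>n < \<tau>\<close> the window reaches back to period 0 and contains all
  demand so far together with the initial backorders. Later, the arrivals are orders of the policy
  itself and \<open>near_position_base_stock\<close> applies.\<close>

lemma unmet_le_bound:
  fixes c :: nat and D :: "nat \<Rightarrow> nat" and \<xi> :: "nat \<Rightarrow> nat \<Rightarrow> bool"
  assumes "pipeline_length x = \<tau>" "\<tau> > 0"
  defines "y \<equiv> state_after (base_stock ((\<tau> + 1) * c)) D \<xi> x"
  shows "unmet (D (Suc n)) (y n) \<le> unmet_bound \<tau> c (fst (snd x)) D (Suc n)"
proof -
  have len: "pipeline_length (y n) = \<tau>" for n
    unfolding y_def using assms by (simp add: pipeline_length_state_after)
  let ?e = "shortage \<tau> c (fst (snd x)) D"
  show ?thesis
  proof (cases "n < \<tau>")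
    case True
    have *: "(\<Sum>k = 1..Suc n. ?e k) = (\<Sum>k = 1..Suc n. D k)"
      using True by (intro sum.cong) (auto simp: shortage_def)
    have "unmet_bound \<tau> c (fst (snd x)) D (Suc n) = (\<Sum>k = 0..Suc n. ?e k)"
      using True by (simp add: unmet_bound_def)
    also have "\<dots> = fst (snd x) + (\<Sum>k = 1..Suc n. D k)"
      using * by (simp add: sum.atLeast_Suc_atMost shortage_def)
    finally have "unmet_bound \<tau> c (fst (snd x)) D (Suc n) = fst (snd x) + (\<Sum>k = 1..Suc n. D k)" .
    moreover have "(\<Sum>k = 1..Suc n. D k) = (\<Sum>k = 1..n. D k) + D (Suc n)"
      by simp
    moreover have "near_position 0 (y n) \<ge> - int (fst (snd x)) - int (\<Sum>k = 1..n. D k)"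
      unfolding y_def using assms by (intro near_position_0_ge) simp
    moreover have "near_position 0 (y n) \<le> near_position 1 (y n)"
      using near_position_Suc_ge[of 0 "y n"] by simp
    moreover have "int (unmet (D (Suc n)) (y n)) = max 0 (int (D (Suc n)) - near_position 1 (y n))"
      using unmet_near_position len assms by simp
    ultimately show ?thesis by linarith
  next
    case False
    define m where "m = n - \<tau>"
    have n: "n = m + \<tau>" using False by (simp add: m_def)
    have "near_position (\<tau> - (\<tau> - 1)) (y (Suc m + (\<tau> - 1)))
        \<ge> int ((\<tau> + 1) * c) - int (\<Sum>k = Suc m..Suc m + (\<tau> - 1). D k)"
      unfolding y_def using assms by (intro near_position_base_stock) auto
    moreover have "\<tau> - (\<tau> - 1) = 1" "Suc m + (\<tau> - 1) = n" using assms n by auto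
    ultimately have 1: "near_position 1 (y n) \<ge> int ((\<tau> + 1) * c) - int (\<Sum>k = Suc m..n. D k)"
      by metis
    have 2: "(\<Sum>k = Suc m..Suc n. D k) = (\<Sum>k = Suc m..n. D k) + D (Suc n)"
      using n by simp
    \<comment> \<open>The window has \<open>\<tau> + 1\<close> periods, so an allowance of
      \<open>c\<close> per period adds up to exactly the base-stock level.\<close>
    have "(\<Sum>k = Suc m..Suc n. D k) \<le> (\<Sum>k = Suc m..Suc n. ?e k + c)"
      by (intro sum_mono) (auto simp: shortage_def)
    also have "\<dots> = unmet_bound \<tau> c (fst (snd x)) D (Suc n) + (\<tau> + 1) * c"
      using n by (simp add: sum.distrib unmet_bound_def Suc_diff_le)
    finally have 3: "(\<Sum>k = Suc m..Suc n. D k) \<le> unmet_bound \<tau> c (fst (snd x)) D (Suc n) + (\<tau> + 1) * c" .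
    have 4: "int (unmet (D (Suc n)) (y n)) = max 0 (int (D (Suc n)) - near_position 1 (y n))"
      using unmet_near_position len assms by simp
    from 1 2 3 4 show ?thesis by linarith
  qed
qed

text \<open>One period raises the excess by at most \<open>unmet_bound\<close> minus demand. By
  \<open>pending_Suc\<close>, adding the pending charges trades \<open>unmet_bound\<close>, which
  looks back over a window, for a multiple of the newest share alone. If the excess drops to 0, only
  the pending charges remain, which is the second argument of the maximum.\<close>

lemma excess_le_bound:
  fixes c :: nat and D :: "nat \<Rightarrow> nat" and \<xi> :: "nat \<Rightarrow> nat \<Rightarrow> bool"
  assumes "pipeline_length x = \<tau>" "\<tau> > 0"
  defines "y \<equiv> state_after (base_stock ((\<tau> + 1) * c)) D \<xi> x"
  defines "b \<equiv> fst (snd x)" and "v \<equiv> nat (inventory_position x)"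
  shows "max 0 (real_of_int (inventory_position (y n)) - real ((\<tau> + 1) * c)) + real (pending \<tau> c b D n)
           \<le> excess_bound \<tau> c b v D n"
proof (induction n)
  case 0
  have "real_of_int (inventory_position x) \<le> real v + real ((\<tau> + 1) * c)"
    unfolding v_def by linarith
  then show ?case by (simp add: y_def del: of_nat_mult)
next
  case (Suc n)
  let ?s = "(\<tau> + 1) * c"
  let ?d = "D (Suc n)"
  have len: "pipeline_length (y n) = \<tau>" for n
    unfolding y_def using assms by (simp add: pipeline_length_state_after)
  have "inventory_position (y (Suc n)) \<le> inventory_position (y n) + int (base_stock ?s (Suc n) (y n))
      - int ?d + int (unmet ?d (y n))"
    using inventory_position_step(2)[of "y n"] len assms by (simp add: y_def Let_def)
  also have "\<dots> = max (int ?s) (inventory_position (y n)) - int ?d + int (unmet ?d (y n))"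
    by (simp only: inventory_position_base_stock)
  also have "\<dots> \<le> max (int ?s) (inventory_position (y n)) - int ?d + int (unmet_bound \<tau> c b D (Suc n))"
    using unmet_le_bound[OF assms(1,2), of D n c \<xi>] by (simp add: b_def y_def)
  finally have "real_of_int (inventory_position (y (Suc n))) \<le> real_of_int (max (int ?s) (inventory_position (y n))
      - int ?d + int (unmet_bound \<tau> c b D (Suc n)))"
    using of_int_le_iff by blast
  then have 1: "real_of_int (inventory_position (y (Suc n))) \<le> max (real ?s) (real_of_int (inventory_position (y n)))
      - real ?d + real (unmet_bound \<tau> c b D (Suc n))"
    by (simp add: of_int_max del: of_nat_mult)
  have 2: "real (pending \<tau> c b D (Suc n)) + real (unmet_bound \<tau> c b D (Suc n))
     = real (pending \<tau> c b D n) + (real \<tau> + 1) * real (shortage \<tau> c b D (Suc n))"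
    using arg_cong[OF pending_Suc, of real] by (simp add: algebra_simps)
  show ?case
    using 1 2 Suc by (simp del: of_nat_mult)
qed

text \<open>Holds period by period: dropping the carried backorders only lowers sales, and on-hand
  stock is at most the level plus excess plus unmet demand. The right-hand side no longer involves
  the patience marks.\<close>

lemma total_profit_base_stock_ge:
  assumes "pipeline_length x = \<tau>" "\<tau> > 0" "r \<ge> 0" "h \<ge> 0"
  defines "b \<equiv> fst (snd x)" and "v \<equiv> nat (inventory_position x)"
  shows "total_profit r h (base_stock ((\<tau> + 1) * c)) D \<xi> x N \<ge>
    (\<Sum>n = 1..N. r * (real (D n) - real (unmet_bound \<tau> c b D n))
       - h * (real ((\<tau> + 1) * c) + excess_bound \<tau> c b v D n + real (unmet_bound \<tau> c b D n)))"
  unfolding total_profit_def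
proof (rule sum_mono)
  fix i assume "i \<in> {1..N}"
  then obtain n where i: "i = Suc n" by (cases i) auto
  let ?s = "(\<tau> + 1) * c"
  define y where "y = state_after (base_stock ?s) D \<xi> x"
  let ?u = "unmet (D i) (y n)"
  have len: "pipeline_length (y n) = \<tau>" for n
    unfolding y_def using assms by (simp add: pipeline_length_state_after)
  have y: "y i = step (base_stock ?s i (y n)) (D i) (\<xi> i) (y n)"
    by (simp add: i y_def Let_def)
  have u: "real ?u \<le> real (unmet_bound \<tau> c b D i)"
    using unmet_le_bound[OF assms(1,2), of D n c \<xi>] by (simp add: b_def y_def i)
  have "int (fst (y i)) \<le> inventory_position (y i) + int ?u"
    using inventory_position_step(3) len assms by (simp add: y)
  then have "real_of_int (int (fst (y i))) \<le> real_of_int (inventory_position (y i) + int ?u)"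
    using of_int_le_iff by blast
  then have "real (fst (y i)) \<le> real ?s + excess_bound \<tau> c b v D i + real ?u"
    using excess_le_bound[OF assms(1,2), of c D \<xi> i] by (simp add: y_def b_def v_def)
  with u have "h * real (fst (y i)) \<le> h * (real ?s + excess_bound \<tau> c b v D i + real (unmet_bound \<tau> c b D i))"
    using assms by (intro mult_left_mono) auto
  moreover have "r * (real (D i) - real (unmet_bound \<tau> c b D i)) \<le> r * (real (fst (snd (y n))) + real (D i) - real ?u)"
    using assms u by (intro mult_left_mono) auto
  moreover have "period_profit r h (D i) (y n)
      = r * (real (fst (snd (y n))) + real (D i) - real ?u) - h * real (fst (y i))"
    unfolding y by (rule period_profit_eq)
  ultimately show "r * (real (D i) - real (unmet_bound \<tau> c b D i))
       - h * (real ?s + excess_bound \<tau> c b v D i + real (unmet_bound \<tau> c b D i))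
    \<le> period_profit r h (D i) (state_after (base_stock ?s) D \<xi> x (i - 1))"
    by (simp add: i y_def)
qed

section \<open>Dependence of the bounds on finitely many demands, and measurability\<close>

lemma shortage_cong: "(k \<ge> 1 \<Longrightarrow> f k = g k) \<Longrightarrow> shortage \<tau> c b f k = shortage \<tau> c b g k"
  by (simp add: shortage_def)

lemma pending_cong: "(\<And>k. 1 \<le> k \<Longrightarrow> k \<le> n \<Longrightarrow> f k = g k) \<Longrightarrow> pending \<tau> c b f n = pending \<tau> c b g n"
  unfolding pending_def by (intro sum.cong refl arg_cong2[where f = "(*)"] shortage_cong) auto

lemma excess_bound_cong:
  "(\<And>k. 1 \<le> k \<Longrightarrow> k \<le> n \<Longrightarrow> f k = g k) \<Longrightarrow> excess_bound \<tau> c b v f n = excess_bound \<tau> c b v g n"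
proof (induction n)
  case 0
  then show ?case using pending_cong[of 0 f g] by simp
next
  case (Suc n)
  have "shortage \<tau> c b f (Suc n) = shortage \<tau> c b g (Suc n)" using Suc.prems by (intro shortage_cong) auto
  then show ?case using Suc pending_cong[of "Suc n" f g] by simp
qed

lemma pending_le_unmet_bound: "pending \<tau> c b f n \<le> \<tau> * unmet_bound \<tau> c b f n"
proof -
  let ?e = "shortage \<tau> c b f"
  have "pending \<tau> c b f n = (\<Sum>k = n - \<tau>..n. (k + \<tau> - n) * ?e k)"
    unfolding pending_def by (rule sum.mono_neutral_right) auto
  also have "\<dots> \<le> (\<Sum>k = n - \<tau>..n. \<tau> * ?e k)"
    by (intro sum_mono mult_right_mono) auto
  finally show ?thesis by (simp add: unmet_bound_def sum_distrib_left)
qed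

lemma excess_bound_nonneg: "excess_bound \<tau> c b v f n \<ge> 0"
  by (cases n) (auto simp: le_max_iff_disj)

lemma measurable_shortage_PiM:
  assumes "k \<le> m"
  shows "(\<lambda>f. real (shortage \<tau> c b f k)) \<in> borel_measurable (PiM {1..m} (\<lambda>_. count_space UNIV))"
\<comment> \<open>The product space has no coordinate 0, but the share of period 0 is the constant
  \<open>b\<close>.\<close>
proof (cases "k = 0")
  case False
  then have "(\<lambda>f. f k) \<in> measurable (PiM {1..m} (\<lambda>_. count_space UNIV :: nat measure)) (count_space UNIV)"
    using assms by (intro measurable_component_singleton) auto
  then have "(\<lambda>f. real (if k \<le> \<tau> then f k else f k - c)) \<in> borel_measurable (PiM {1..m} (\<lambda>_. count_space UNIV))"
    by (rule measurable_compose) simp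
  then show ?thesis using False by (simp add: shortage_def)
qed (simp add: shortage_def)

lemma measurable_pending_PiM:
  assumes "n \<le> m"
  shows "(\<lambda>f. real (pending \<tau> c b f n)) \<in> borel_measurable (PiM {1..m} (\<lambda>_. count_space UNIV))"
  unfolding pending_def of_nat_sum of_nat_mult
  using assms by (intro borel_measurable_sum borel_measurable_times borel_measurable_const measurable_shortage_PiM) auto

lemma measurable_excess_bound_PiM:
  "n \<le> m \<Longrightarrow> (\<lambda>f. excess_bound \<tau> c b v f n) \<in> borel_measurable (PiM {1..m} (\<lambda>_. count_space UNIV))"
proof (induction n)
  case 0
  then show ?case using measurable_pending_PiM[of 0 m] by simp
next
  case (Suc n)
  have "(\<lambda>f. f (Suc n)) \<in> measurable (PiM {1..m} (\<lambda>_. count_space UNIV :: nat measure)) (count_space UNIV)"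
    using Suc.prems by (intro measurable_component_singleton) auto
  then have "(\<lambda>f. real (f (Suc n))) \<in> borel_measurable (PiM {1..m} (\<lambda>_. count_space UNIV))"
    by (rule measurable_compose) simp
  then show ?case
    using Suc measurable_pending_PiM[of "Suc n" m] measurable_shortage_PiM[of "Suc n" m] by simp
qed

section \<open>Summing a drift inequality, and bounds for the extended expectation\<close>

text \<open>Telescoping of a Foster-Lyapunov condition, with \<open>a\<close> the expected Lyapunov
  function. The drift is available only after an initial phase of length \<open>m\<close>, whose
  contribution goes into the constant.\<close>

lemma sum_le_linear_of_drift:
  fixes a z :: "nat \<Rightarrow> real"
  assumes "\<delta> > 0" "C \<ge> 0" and nonneg: "\<And>n. a n \<ge> 0" "\<And>n. z n \<ge> 0"
    and drift: "\<And>n. n \<ge> m \<Longrightarrow> a (Suc n) \<le> a n - \<delta> * z n + C"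
  obtains A where "A \<ge> 0" "\<And>N. (\<Sum>n = 1..N. z n) \<le> A * (real N + 1)"
proof -
  define A0 where "A0 = a m + \<delta> * (\<Sum>n<m. z n)"
  have A0: "A0 \<ge> 0" using assms by (simp add: A0_def sum_nonneg)
  have *: "\<delta> * (\<Sum>n<m + j. z n) + a (m + j) \<le> A0 + C * real j" for j
  proof (induction j)
    case (Suc j)
    then show ?case using drift[of "m + j"] by (simp add: algebra_simps)
  qed (simp add: A0_def)
  have "(\<Sum>n = 1..N. z n) \<le> ((A0 + C) / \<delta>) * (real N + 1)" for N
  proof -
    have "(\<Sum>n = 1..N. z n) \<le> (\<Sum>n<m + Suc N. z n)"
      using nonneg by (intro sum_mono2) auto
    also have "\<dots> \<le> (A0 + C * real (Suc N)) / \<delta>"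
      using *[of "Suc N"] nonneg(1)[of "m + Suc N"] \<open>\<delta> > 0\<close> by (simp add: field_simps)
    also have "\<dots> \<le> ((A0 + C) / \<delta>) * (real N + 1)"
      using A0 \<open>\<delta> > 0\<close> by (simp add: field_simps)
    finally show ?thesis .
  qed
  moreover have "(A0 + C) / \<delta> \<ge> 0" using assms A0 by simp
  ultimately show ?thesis using that by blast
qed

text \<open>No measurability of \<open>f\<close> is required, since \<open>nn_integral\<close> is
  monotone on all functions. The profit itself is therefore never shown to be measurable.\<close>

lemma ext_expectation_ge:
  assumes "integrable M g" "\<And>w. g w \<le> f w"
  shows "ereal (integral\<^sup>L M g) \<le> ext_expectation M f"
proof -
  have fin: "(\<integral>\<^sup>+ w. ennreal (g w) \<partial>M) < \<infinity>" "(\<integral>\<^sup>+ w. ennreal (- g w) \<partial>M) < \<infinity>"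
    using assms(1) by (auto simp: real_integrable_def less_top)
  have "ereal (integral\<^sup>L M g) = ext_expectation M g"
    unfolding ext_expectation_def real_lebesgue_integral_def[OF assms(1)]
    using fin by (cases rule: ennreal2_cases[of "\<integral>\<^sup>+ w. ennreal (g w) \<partial>M" "\<integral>\<^sup>+ w. ennreal (- g w) \<partial>M"]) auto
  also have "\<dots> \<le> ext_expectation M f"
    unfolding ext_expectation_def
    using assms(2)
    by (intro ereal_minus_mono)
       (auto intro!: nn_integral_mono ennreal_leI simp flip: less_eq_ennreal.rep_eq)
  finally show ?thesis .
qed

lemma ext_expectation_le:
  assumes "integrable M g" "\<And>w. f w \<le> g w" "\<And>w. 0 \<le> g w"
  shows "ext_expectation M f \<le> ereal (integral\<^sup>L M g)"
proof -
  have "ext_expectation M f \<le> enn2ereal (\<integral>\<^sup>+ w. ennreal (f w) \<partial>M) - 0"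
    unfolding ext_expectation_def by (intro ereal_minus_mono) auto
  also have "\<dots> \<le> enn2ereal (\<integral>\<^sup>+ w. ennreal (g w) \<partial>M)"
    using assms(2) by (simp add: ennreal_leI nn_integral_mono less_eq_ennreal.rep_eq[symmetric])
  also have "\<dots> = ereal (integral\<^sup>L M g)"
    using assms by (subst nn_integral_eq_integral) (auto simp: enn2ereal_ennreal integral_nonneg_AE)
  finally show ?thesis .
qed

lemma affine_div_of_nat_tendsto: "(\<lambda>n. (b + real n * a) / real n) \<longlonglongrightarrow> a"
proof -
  have "(\<lambda>n. b / real n + a) \<longlonglongrightarrow> 0 + a"
    by (intro tendsto_add tendsto_const lim_const_over_n)
  moreover have "\<forall>\<^sub>F n in sequentially. b / real n + a = (b + real n * a) / real n"
    using eventually_gt_at_top[of 0] by eventually_elim (simp add: field_simps)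
  ultimately show ?thesis by (simp add: Lim_transform_eventually)
qed

section \<open>Closure properties of square-integrable functions\<close>

definition square_integrable :: "'a measure \<Rightarrow> ('a \<Rightarrow> real) \<Rightarrow> bool" where
  "square_integrable M f \<longleftrightarrow> f \<in> borel_measurable M \<and> integrable M (\<lambda>w. (f w)\<^sup>2)"

lemma square_integrable_bound:
  assumes "square_integrable M g" "f \<in> borel_measurable M" "\<And>w. \<bar>f w\<bar> \<le> \<bar>g w\<bar>"
  shows "square_integrable M f"
  unfolding square_integrable_def
proof
  show "integrable M (\<lambda>w. (f w)\<^sup>2)"
    by (rule Bochner_Integration.integrable_bound[where f = "\<lambda>w. (g w)\<^sup>2"])
       (use assms in \<open>auto simp: square_integrable_def abs_le_square_iff\<close>)
qed fact

lemma square_integrable_add: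
  assumes "square_integrable M f" "square_integrable M g"
  shows "square_integrable M (\<lambda>w. f w + g w)"
proof -
  have *: "(x + y)\<^sup>2 \<le> 2 * x\<^sup>2 + 2 * y\<^sup>2" for x y :: real
    using zero_le_power2[of "x - y"] by (simp add: power2_eq_square algebra_simps)
  show ?thesis
    unfolding square_integrable_def
  proof
    show "integrable M (\<lambda>w. (f w + g w)\<^sup>2)"
      by (rule Bochner_Integration.integrable_bound[where f = "\<lambda>w. 2 * (f w)\<^sup>2 + 2 * (g w)\<^sup>2"])
         (use assms * in \<open>auto simp: square_integrable_def\<close>)
  qed (use assms in \<open>auto simp: square_integrable_def\<close>)
qed

lemma square_integrable_cmult:
  assumes "square_integrable M f"
  shows "square_integrable M (\<lambda>w. a * f w)"
  using assms by (auto simp: square_integrable_def power_mult_distrib)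

lemma square_integrable_diff:
  assumes "square_integrable M f" "square_integrable M g"
  shows "square_integrable M (\<lambda>w. f w - g w)"
  using square_integrable_add[OF assms(1) square_integrable_cmult[OF assms(2), of "-1"]] by simp

lemma square_integrable_max:
  assumes "square_integrable M f" "square_integrable M g"
  shows "square_integrable M (\<lambda>w. max (f w) (g w))"
proof (rule square_integrable_bound)
  show "square_integrable M (\<lambda>w. \<bar>f w\<bar> + \<bar>g w\<bar>)"
    using assms by (intro square_integrable_add) (auto simp: square_integrable_def)
qed (use assms in \<open>auto simp: square_integrable_def\<close>)

lemma (in finite_measure) square_integrable_const: "square_integrable M (\<lambda>w. a)"
  by (simp add: square_integrable_def)

lemma (in finite_measure) square_integrable_sum:
  assumes "\<And>i. i \<in> I \<Longrightarrow> square_integrable M (f i)"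
  shows "square_integrable M (\<lambda>w. \<Sum>i\<in>I. f i w)"
  using assms
  by (induction I rule: infinite_finite_induct) (auto intro: square_integrable_const square_integrable_add)

lemma (in finite_measure) square_integrable_integrable:
  "square_integrable M f \<Longrightarrow> integrable M f"
  by (auto simp: square_integrable_def intro: square_integrable_imp_integrable)

lemma square_integrable_integrable_power2:
  "square_integrable M f \<Longrightarrow> integrable M (\<lambda>w. (f w)\<^sup>2)"
  by (simp add: square_integrable_def)

section \<open>Moments and independence for i.i.d. demand\<close>

text \<open>Only demands are constrained because both profit bounds hold for every realization of
  the patience marks. A second moment is what the quadratic Lyapunov function consumes.\<close>

locale iid_demand = prob_space M for M :: "'w measure" +
  fixes D :: "nat \<Rightarrow> 'w \<Rightarrow> nat"
  assumes indep: "indep_vars (\<lambda>_. count_space UNIV) D {1..}"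
    and ident: "\<And>i. i \<ge> 1 \<Longrightarrow> distr M (count_space UNIV) (D i) = distr M (count_space UNIV) (D 1)"
    and square_integrable_1: "square_integrable M (\<lambda>w. real (D 1 w))"
begin

abbreviation path :: "'w \<Rightarrow> nat \<Rightarrow> nat" where
  "path w \<equiv> \<lambda>i. D i w"

lemma measurable_demand: "i \<ge> 1 \<Longrightarrow> D i \<in> measurable M (count_space UNIV)"
  using indep unfolding indep_vars_def2 by blast

lemma
  fixes f :: "nat \<Rightarrow> real"
  assumes "i \<ge> 1"
  shows integrable_demand_iff: "integrable M (\<lambda>w. f (D i w)) \<longleftrightarrow> integrable M (\<lambda>w. f (D 1 w))"
    and expectation_demand: "expectation (\<lambda>w. f (D i w)) = expectation (\<lambda>w. f (D 1 w))"
proof -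
  have f: "f \<in> borel_measurable (count_space UNIV)" by simp
  note m = measurable_demand[OF assms] measurable_demand[of 1, simplified]
  show "integrable M (\<lambda>w. f (D i w)) \<longleftrightarrow> integrable M (\<lambda>w. f (D 1 w))"
    using integrable_distr_eq[OF m(1) f] integrable_distr_eq[OF m(2) f] ident[OF assms] by simp
  show "expectation (\<lambda>w. f (D i w)) = expectation (\<lambda>w. f (D 1 w))"
    using integral_distr[OF m(1) f] integral_distr[OF m(2) f] ident[OF assms] by simp
qed

lemma borel_measurable_demand:
  fixes f :: "nat \<Rightarrow> real"
  assumes "i \<ge> 1"
  shows "(\<lambda>w. f (D i w)) \<in> borel_measurable M"
  using measurable_demand[OF assms] by (rule measurable_compose) simp

lemma square_integrable_demand:
  assumes "i \<ge> 1"
  shows "square_integrable M (\<lambda>w. real (D i w))"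
  using square_integrable_1 borel_measurable_demand[OF assms]
    integrable_demand_iff[OF assms, of "\<lambda>k. (real k)\<^sup>2"]
  unfolding square_integrable_def by blast

lemma square_integrable_shortage:
  "square_integrable M (\<lambda>w. real (shortage \<tau> c b (path w) k))"
proof (cases "k = 0")
  case False
  have "square_integrable M (\<lambda>w. real (D k w - c))"
    by (rule square_integrable_bound[OF square_integrable_demand[of k]])
       (use False in \<open>auto intro!: borel_measurable_demand\<close>)
  then show ?thesis
    using False square_integrable_demand[of k] by (cases "k \<le> \<tau>") (simp_all add: shortage_def)
qed (simp add: shortage_def square_integrable_const)

lemma square_integrable_unmet_bound:
  "square_integrable M (\<lambda>w. real (unmet_bound \<tau> c b (path w) n))"
  by (simp add: unmet_bound_def square_integrable_sum square_integrable_shortage)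

lemma square_integrable_pending:
  "square_integrable M (\<lambda>w. real (pending \<tau> c b (path w) n))"
  by (simp add: pending_def square_integrable_sum square_integrable_shortage square_integrable_cmult)

lemma square_integrable_excess_bound:
  "square_integrable M (\<lambda>w. excess_bound \<tau> c b v (path w) n)"
  by (induction n)
     (auto intro!: square_integrable_max square_integrable_add square_integrable_diff square_integrable_cmult
       square_integrable_const square_integrable_pending square_integrable_shortage square_integrable_demand)

text \<open>The bound reads only the coordinates \<open>{1..n}\<close>, a block disjoint from
  \<open>{Suc n}\<close>.\<close>

lemma indep_excess_bound_demand:
  fixes f :: "nat \<Rightarrow> real"
  shows "indep_var borel (\<lambda>w. excess_bound \<tau> c b v (path w) n) borel (\<lambda>w. f (D (Suc n) w))"
proof -
  let ?N = "\<lambda>_::nat. count_space UNIV :: nat measure"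
  have "indep_var (PiM {1..n} ?N) (\<lambda>w. restrict (path w) {1..n})
      (PiM {Suc n} ?N) (\<lambda>w. restrict (path w) {Suc n})"
    by (rule indep_var_restrict[OF indep]) auto
  moreover have "(\<lambda>g. f (g (Suc n))) \<in> borel_measurable (PiM {Suc n} ?N)"
    by (rule measurable_compose[of _ _ "count_space UNIV"]) (auto intro: measurable_component_singleton)
  ultimately have "indep_var borel ((\<lambda>g. excess_bound \<tau> c b v g n) \<circ> (\<lambda>w. restrict (path w) {1..n}))
      borel ((\<lambda>g. f (g (Suc n))) \<circ> (\<lambda>w. restrict (path w) {Suc n}))"
    by (rule indep_var_compose[OF _ measurable_excess_bound_PiM[OF order_refl]])
  moreover have "(\<lambda>g. excess_bound \<tau> c b v g n) \<circ> (\<lambda>w. restrict (path w) {1..n}) = (\<lambda>w. excess_bound \<tau> c b v (path w) n)"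
    unfolding comp_def by (intro ext excess_bound_cong) simp
  ultimately show ?thesis by (simp add: comp_def)
qed

lemma tail_mean_tendsto_0: "(\<lambda>c. expectation (\<lambda>w. real (D 1 w - c))) \<longlonglongrightarrow> 0"
proof -
  have "(\<lambda>c. expectation (\<lambda>w. real (D 1 w - c))) \<longlonglongrightarrow> expectation (\<lambda>w. 0)"
  proof (rule integral_dominated_convergence[where w = "\<lambda>w. real (D 1 w)"])
    show "integrable M (\<lambda>w. real (D 1 w))"
      by (rule square_integrable_integrable[OF square_integrable_1])
    show "AE w in M. (\<lambda>c. real (D 1 w - c)) \<longlonglongrightarrow> 0"
    proof (rule AE_I2)
      fix w
      have "\<forall>\<^sub>F c in sequentially. real (D 1 w - c) = 0"
        using eventually_ge_at_top[of "D 1 w"] by eventually_elim simp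
      then show "(\<lambda>c. real (D 1 w - c)) \<longlonglongrightarrow> 0" by (rule tendsto_eventually)
    qed
  qed (auto intro!: borel_measurable_demand)
  then show ?thesis by simp
qed

text \<open>For \<open>n > 2 * \<tau>\<close> the whole window lies beyond period
  \<open>\<tau>\<close>, so each of its \<open>\<tau> + 1\<close> shares is a truncated
  demand.\<close>

lemma expectation_unmet_bound:
  assumes "n > 2 * \<tau>"
  shows "expectation (\<lambda>w. real (unmet_bound \<tau> c b (path w) n))
    = (real \<tau> + 1) * expectation (\<lambda>w. real (D 1 w - c))"
proof -
  have "expectation (\<lambda>w. real (unmet_bound \<tau> c b (path w) n))
      = (\<Sum>k = n - \<tau>..n. expectation (\<lambda>w. real (shortage \<tau> c b (path w) k)))"
    by (simp add: unmet_bound_def square_integrable_integrable[OF square_integrable_shortage])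
  also have "\<dots> = (\<Sum>k = n - \<tau>..n. expectation (\<lambda>w. real (D 1 w - c)))"
  proof (rule sum.cong[OF refl])
    fix k assume "k \<in> {n - \<tau>..n}"
    then have "k > \<tau>" using assms by auto
    then show "expectation (\<lambda>w. real (shortage \<tau> c b (path w) k)) = expectation (\<lambda>w. real (D 1 w - c))"
      using expectation_demand[of k "\<lambda>d. real (d - c)"] by (simp add: shortage_def)
  qed
  finally show ?thesis using assms by (simp add: algebra_simps Suc_diff_le)
qed

text \<open>Cauchy-Schwarz over a window of at most \<open>\<tau> + 1\<close> shares, each being
  \<open>b\<close> or at most one demand. The bound is uniform in \<open>n\<close>, as the additive
  constant of the drift must be.\<close>

lemma expectation_pending_square_le:
  "expectation (\<lambda>w. (real (pending \<tau> c b (path w) n))\<^sup>2)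
    \<le> (real \<tau>)\<^sup>2 * (real \<tau> + 1)\<^sup>2 * ((real b)\<^sup>2 + expectation (\<lambda>w. (real (D 1 w))\<^sup>2))"
proof -
  let ?e = "\<lambda>w k. real (shortage \<tau> c b (path w) k)"
  let ?m = "expectation (\<lambda>w. (real (D 1 w))\<^sup>2)"
  let ?K = "{n - \<tau>..n}"
  have card: "real (card ?K) \<le> real \<tau> + 1" by auto
  have sq: "(real (pending \<tau> c b f n))\<^sup>2
      \<le> (real \<tau>)\<^sup>2 * ((\<Sum>k\<in>?K. (real (shortage \<tau> c b f k))\<^sup>2) * (real \<tau> + 1))" for f
  proof -
    have "real (pending \<tau> c b f n) \<le> real \<tau> * (\<Sum>k\<in>?K. real (shortage \<tau> c b f k))"
      using pending_le_unmet_bound[of \<tau> c b f n]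
      by (simp add: unmet_bound_def flip: of_nat_sum of_nat_mult)
    then have "(real (pending \<tau> c b f n))\<^sup>2 \<le> (real \<tau>)\<^sup>2 * (\<Sum>k\<in>?K. real (shortage \<tau> c b f k))\<^sup>2"
      by (metis power_mono power_mult_distrib of_nat_0_le_iff)
    also have "\<dots> \<le> (real \<tau>)\<^sup>2 * ((\<Sum>k\<in>?K. (real (shortage \<tau> c b f k))\<^sup>2) * real (card ?K))"
      by (intro mult_left_mono sum_squared_le_sum_of_squares) auto
    also have "\<dots> \<le> (real \<tau>)\<^sup>2 * ((\<Sum>k\<in>?K. (real (shortage \<tau> c b f k))\<^sup>2) * (real \<tau> + 1))"
      using card by (intro mult_left_mono sum_nonneg) auto
    finally show ?thesis .
  qed
  have e: "expectation (\<lambda>w. (?e w k)\<^sup>2) \<le> (real b)\<^sup>2 + ?m" for k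
  proof (cases "k = 0")
    case True
    then show ?thesis by (simp add: shortage_def prob_space)
  next
    case False
    have "expectation (\<lambda>w. (?e w k)\<^sup>2) \<le> expectation (\<lambda>w. (real (D k w))\<^sup>2)"
      using False by (intro integral_mono square_integrable_integrable_power2 square_integrable_shortage
          square_integrable_demand power_mono) (auto simp: shortage_def)
    also have "\<dots> = ?m" using False by (intro expectation_demand) simp
    finally show ?thesis by (simp add: add_increasing)
  qed
  have int: "integrable M (\<lambda>w. (?e w k)\<^sup>2)" for k
    by (rule square_integrable_integrable_power2[OF square_integrable_shortage])
  have "expectation (\<lambda>w. (real (pending \<tau> c b (path w) n))\<^sup>2)
      \<le> expectation (\<lambda>w. (real \<tau>)\<^sup>2 * ((\<Sum>k\<in>?K. (?e w k)\<^sup>2) * (real \<tau> + 1)))"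
    by (intro integral_mono sq square_integrable_integrable_power2 square_integrable_pending) (auto intro: int)
  also have "\<dots> = (real \<tau>)\<^sup>2 * ((\<Sum>k\<in>?K. expectation (\<lambda>w. (?e w k)\<^sup>2)) * (real \<tau> + 1))"
    by (simp add: int)
  also have "\<dots> \<le> (real \<tau>)\<^sup>2 * ((\<Sum>k\<in>?K. (real b)\<^sup>2 + ?m) * (real \<tau> + 1))"
    by (intro mult_left_mono mult_right_mono sum_mono e) auto
  also have "\<dots> = (real \<tau>)\<^sup>2 * (real (card ?K) * ((real b)\<^sup>2 + ?m) * (real \<tau> + 1))"
    by simp
  also have "\<dots> \<le> (real \<tau>)\<^sup>2 * ((real \<tau> + 1) * ((real b)\<^sup>2 + ?m) * (real \<tau> + 1))"
    using card by (intro mult_left_mono mult_right_mono) auto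
  finally show ?thesis by (simp add: power2_eq_square algebra_simps)
qed

text \<open>The square of a maximum is at most the sum of the two squares. Expanding the first, its
  cross term factors by independence; \<open>n \<ge> \<tau>\<close> ensures that the new share is
  already truncated.\<close>

lemma excess_bound_drift:
  fixes \<tau> c b v :: nat
  defines "z \<equiv> \<lambda>n w. excess_bound \<tau> c b v (path w) n"
    and "jump \<equiv> \<lambda>d. (real \<tau> + 1) * real (d - c) - real d"
  assumes "n \<ge> \<tau>"
  shows "expectation (\<lambda>w. (z (Suc n) w)\<^sup>2)
    \<le> expectation (\<lambda>w. (z n w)\<^sup>2) + 2 * expectation (z n) * expectation (\<lambda>w. jump (D 1 w))
      + (expectation (\<lambda>w. (jump (D 1 w))\<^sup>2)
         + (real \<tau>)\<^sup>2 * (real \<tau> + 1)\<^sup>2 * ((real b)\<^sup>2 + expectation (\<lambda>w. (real (D 1 w))\<^sup>2)))"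
proof -
  let ?j = "\<lambda>w. jump (D (Suc n) w)"
  let ?p = "\<lambda>w. real (pending \<tau> c b (path w) (Suc n))"
  have z: "square_integrable M (z k)" for k
    unfolding z_def by (rule square_integrable_excess_bound)
  have p: "square_integrable M ?p" by (rule square_integrable_pending)
  have sh: "real (shortage \<tau> c b (path w) (Suc n)) = real (D (Suc n) w - c)" for w
    using assms by (simp add: shortage_def)
  have j: "square_integrable M ?j"
    unfolding jump_def sh[symmetric]
    by (intro square_integrable_diff square_integrable_cmult square_integrable_shortage square_integrable_demand) simp
  have ind: "indep_var borel (z n) borel ?j"
    unfolding z_def by (rule indep_excess_bound_demand)
  note zj = indep_var_integrable[OF ind] indep_var_lebesgue_integral[OF ind]
  have int: "integrable M (\<lambda>w. (z n w)\<^sup>2)" "integrable M (\<lambda>w. (?j w)\<^sup>2)" "integrable M (\<lambda>w. (?p w)\<^sup>2)"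
    "integrable M (z n)" "integrable M ?j"
    by (intro square_integrable_integrable_power2 square_integrable_integrable z p j)+
  have "expectation (\<lambda>w. (z (Suc n) w)\<^sup>2)
      \<le> expectation (\<lambda>w. (z n w)\<^sup>2 + 2 * (z n w * ?j w) + (?j w)\<^sup>2 + (?p w)\<^sup>2)"
  proof (rule integral_mono)
    show "integrable M (\<lambda>w. (z n w)\<^sup>2 + 2 * (z n w * ?j w) + (?j w)\<^sup>2 + (?p w)\<^sup>2)"
      using int zj by auto
    fix w
    have zs: "z (Suc n) w = max (z n w + ?j w) (?p w)"
      by (simp add: z_def jump_def sh)
    have "(z (Suc n) w)\<^sup>2 \<le> (z n w + ?j w)\<^sup>2 + (?p w)\<^sup>2"
      unfolding zs by (simp add: max_def)
    also have "\<dots> = (z n w)\<^sup>2 + 2 * (z n w * ?j w) + (?j w)\<^sup>2 + (?p w)\<^sup>2"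
      by (simp add: power2_eq_square algebra_simps)
    finally show "(z (Suc n) w)\<^sup>2 \<le> \<dots>" .
  qed (rule square_integrable_integrable_power2[OF z])
  also have "\<dots> = expectation (\<lambda>w. (z n w)\<^sup>2) + 2 * (expectation (z n) * expectation ?j)
      + expectation (\<lambda>w. (?j w)\<^sup>2) + expectation (\<lambda>w. (?p w)\<^sup>2)"
    using int zj by simp
  also have "expectation ?j = expectation (\<lambda>w. jump (D 1 w))"
    by (intro expectation_demand) simp
  also have "expectation (\<lambda>w. (?j w)\<^sup>2) = expectation (\<lambda>w. (jump (D 1 w))\<^sup>2)"
    by (intro expectation_demand[where f = "\<lambda>d. (jump d)\<^sup>2"]) simp
  finally show ?thesis using expectation_pending_square_le[of \<tau> c b "Suc n"] by simp
qed

section \<open>Expected and long-run average profit\<close>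

text \<open>The order of quantifiers is the point: \<open>c\<close> and \<open>A\<close> are fixed
  before \<open>r\<close> and \<open>N\<close>, so the cost rate \<open>A\<close> becomes negligible
  as \<open>r\<close> grows.\<close>

lemma base_stock_profit_lower_bound:
  fixes \<tau> b v :: nat and h \<epsilon> :: real
  defines "\<mu> \<equiv> expectation (\<lambda>w. real (D 1 w))"
  defines "g \<equiv> \<lambda>c r N w. \<Sum>n = 1..N. r * (real (D n w) - real (unmet_bound \<tau> c b (path w) n))
       - h * (real ((\<tau> + 1) * c) + excess_bound \<tau> c b v (path w) n + real (unmet_bound \<tau> c b (path w) n))"
  assumes "\<mu> > 0" "\<epsilon> > 0" "h \<ge> 0"
  obtains c A where "\<And>r N. integrable M (g c r N)"
    and "\<And>r N. r \<ge> 0 \<Longrightarrow> expectation (g c r N) \<ge> real N * (r * (\<mu> - \<epsilon>) - A) - (r + 1) * A"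
proof -
  define t where "t c = expectation (\<lambda>w. real (D 1 w - c))" for c
  have "(\<lambda>c. (real \<tau> + 1) * t c) \<longlonglongrightarrow> (real \<tau> + 1) * 0"
    unfolding t_def by (intro tendsto_mult tendsto_const tail_mean_tendsto_0)
  \<comment> \<open>Below \<open>\<epsilon>\<close> keeps the rate of unmet demand small; below
    \<open>\<mu> / 2\<close> gives the excess process a negative drift.\<close>
  then have "\<forall>\<^sub>F c in sequentially. (real \<tau> + 1) * t c < min \<epsilon> (\<mu> / 2)"
    using assms by (intro order_tendstoD) auto
  then obtain c where c: "(real \<tau> + 1) * t c < min \<epsilon> (\<mu> / 2)"
    by (auto simp: eventually_sequentially)
  let ?s = "(\<tau> + 1) * c"
  define z where "z = (\<lambda>n w. excess_bound \<tau> c b v (path w) n)"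
  define u where "u = (\<lambda>n w. real (unmet_bound \<tau> c b (path w) n))"
  define y where "y = (real \<tau> + 1) * t c"
  have y: "0 \<le> y" "y \<le> \<epsilon>" "y \<le> \<mu> / 2"
    using c by (auto simp: y_def t_def)
  have sq: "square_integrable M (z n)" "square_integrable M (u n)" for n
    unfolding z_def u_def by (rule square_integrable_excess_bound square_integrable_unmet_bound)+
  have int: "integrable M (z n)" "integrable M (u n)" for n
    by (intro square_integrable_integrable sq)+
  have intD: "integrable M (\<lambda>w. real (D n w))" if "n \<ge> 1" for n
    using that by (intro square_integrable_integrable square_integrable_demand)
  have int1: "integrable M (\<lambda>w. real (D 1 w - c))"
    using intD[of 1] by (rule Bochner_Integration.integrable_bound) (auto intro!: borel_measurable_demand)
  have jump: "expectation (\<lambda>w. (real \<tau> + 1) * real (D 1 w - c) - real (D 1 w)) = y - \<mu>"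
    using int1 intD[of 1] by (simp add: y_def t_def \<mu>_def)
  define C where "C = expectation (\<lambda>w. ((real \<tau> + 1) * real (D 1 w - c) - real (D 1 w))\<^sup>2)
         + (real \<tau>)\<^sup>2 * (real \<tau> + 1)\<^sup>2 * ((real b)\<^sup>2 + expectation (\<lambda>w. (real (D 1 w))\<^sup>2))"
  have "C \<ge> 0" by (simp add: C_def)
  have ez: "expectation (z n) \<ge> 0" for n
    by (simp add: z_def excess_bound_nonneg)
  have drift: "expectation (\<lambda>w. (z (Suc n) w)\<^sup>2) \<le> expectation (\<lambda>w. (z n w)\<^sup>2) - \<mu> * expectation (z n) + C"
    if "n \<ge> \<tau>" for n
  proof -
    have "expectation (\<lambda>w. (z (Suc n) w)\<^sup>2)
        \<le> expectation (\<lambda>w. (z n w)\<^sup>2) + 2 * expectation (z n) * (y - \<mu>) + C"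
      using excess_bound_drift[OF that, of c b v] unfolding C_def z_def jump .
    \<comment> \<open>With \<open>y \<le> \<mu> / 2\<close> the drift coefficient
      \<open>2 * (y - \<mu>)\<close> is at most \<open>- \<mu>\<close>.\<close>
    moreover have "(2 * y) * expectation (z n) \<le> \<mu> * expectation (z n)"
      using y ez by (intro mult_right_mono) auto
    ultimately show ?thesis by (simp add: algebra_simps)
  qed
  obtain A1 where A1: "A1 \<ge> 0" "\<And>N. (\<Sum>n = 1..N. expectation (z n)) \<le> A1 * (real N + 1)"
    using sum_le_linear_of_drift[OF \<open>\<mu> > 0\<close> \<open>C \<ge> 0\<close> , of "\<lambda>n. expectation (\<lambda>w. (z n w)\<^sup>2)" "\<lambda>n. expectation (z n)" \<tau>]
      ez drift by auto
  \<comment> \<open>Absorbs the first \<open>2 * \<tau>\<close> periods, where the formula for the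
    mean of \<open>unmet_bound\<close> is not yet available.\<close>
  define K where "K = (\<Sum>n = 1..2 * \<tau>. expectation (u n))"
  have eu: "expectation (u n) \<ge> 0" for n by (simp add: u_def)
  have "K \<ge> 0" using eu by (simp add: K_def sum_nonneg)
  have K: "(\<Sum>n = 1..N. expectation (u n)) \<le> real N * y + K" for N
  proof -
    have "(\<Sum>n = 1..N. expectation (u n)) \<le> (\<Sum>n = 1..N. y + (if n \<le> 2 * \<tau> then expectation (u n) else 0))"
    proof (rule sum_mono)
      fix n show "expectation (u n) \<le> y + (if n \<le> 2 * \<tau> then expectation (u n) else 0)"
        using y expectation_unmet_bound[of \<tau> n c b] by (simp add: u_def y_def t_def)
    qed
    also have "\<dots> = real N * y + (\<Sum>n \<in> {1..N} \<inter> {n. n \<le> 2 * \<tau>}. expectation (u n))"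
      by (simp add: sum.distrib sum.If_cases)
    also have "(\<Sum>n \<in> {1..N} \<inter> {n. n \<le> 2 * \<tau>}. expectation (u n)) \<le> K"
      unfolding K_def using eu by (intro sum_mono2) auto
    finally show ?thesis by simp
  qed
  \<comment> \<open>One constant serves both as cost rate and as boundary term; the nonnegative
    expressions below are the resulting slack in the coefficients of \<open>N\<close>, of
    \<open>r\<close> and in the constant term.\<close>
  define A where "A = h * real ?s + h * A1 + h * y + K + h * K"
  have g: "g c r N = (\<lambda>w. \<Sum>n = 1..N. r * (real (D n w) - u n w) - h * (real ?s + z n w + u n w))" for r N
    by (simp add: g_def u_def z_def)
  have "integrable M (g c r N)" for r N
    unfolding g using int intD by auto
  moreover have "expectation (g c r N) \<ge> real N * (r * (\<mu> - \<epsilon>) - A) - (r + 1) * A" if "r \<ge> 0" for r N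
  proof -
    let ?U = "\<Sum>n = 1..N. expectation (u n)" and ?Z = "\<Sum>n = 1..N. expectation (z n)"
    have "expectation (g c r N) = (\<Sum>n = 1..N. expectation (\<lambda>w. r * (real (D n w) - u n w) - h * (real ?s + z n w + u n w)))"
      unfolding g using int intD by (intro Bochner_Integration.integral_sum) auto
    also have "\<dots> = (\<Sum>n = 1..N. r * (\<mu> - expectation (u n)) - h * (real ?s + expectation (z n) + expectation (u n)))"
    proof (rule sum.cong[OF refl])
      fix n assume "n \<in> {1..N}"
      then have n: "n \<ge> 1" by simp
      have "expectation (\<lambda>w. real (D n w)) = \<mu>"
        unfolding \<mu>_def using n by (rule expectation_demand)
      then show "expectation (\<lambda>w. r * (real (D n w) - u n w) - h * (real ?s + z n w + u n w))
        = r * (\<mu> - expectation (u n)) - h * (real ?s + expectation (z n) + expectation (u n))"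
        using int intD[OF n] by (simp add: prob_space del: of_nat_mult)
    qed
    also have "\<dots> = r * (real N * \<mu> - ?U) - h * (real N * real ?s + ?Z + ?U)"
      by (simp add: sum_subtractf sum.distrib sum_distrib_left[symmetric] del: of_nat_mult)
    also have "\<dots> \<ge> r * (real N * \<mu> - (real N * y + K)) - h * (real N * real ?s + A1 * (real N + 1) + (real N * y + K))"
      using K[of N] A1(2)[of N] that \<open>h \<ge> 0\<close> by (intro diff_mono mult_left_mono add_mono) auto
    also have "r * (real N * \<mu> - (real N * y + K)) - h * (real N * real ?s + A1 * (real N + 1) + (real N * y + K))
      \<ge> real N * (r * (\<mu> - \<epsilon>) - A) - (r + 1) * A"
    proof -
      have "r * real N * y \<le> r * real N * \<epsilon>"
        using y that by (intro mult_left_mono) auto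
      moreover have "0 \<le> real N * (K + h * K)" "0 \<le> r * (h * real ?s + h * A1 + h * y + h * K)" "0 \<le> h * real ?s + h * y + K"
        using \<open>K \<ge> 0\<close> A1 y that \<open>h \<ge> 0\<close> by (simp_all del: of_nat_mult)
      ultimately show ?thesis
        unfolding A_def by (simp add: algebra_simps del: of_nat_mult of_nat_add)
    qed
    finally show ?thesis .
  qed
  ultimately show ?thesis using that by blast
qed

lemma avg_profit_le:
  assumes "r \<ge> 0" "h \<ge> 0"
  shows "avg_profit M D \<xi> r h \<pi> x \<le> ereal (r * (\<integral>w. real (D 1 w) \<partial>M))"
proof -
  let ?\<mu> = "expectation (\<lambda>w. real (D 1 w))" and ?b = "real (fst (snd x))"
  have int: "integrable M (\<lambda>w. real (D n w))" if "n \<ge> 1" for n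
    using that by (intro square_integrable_integrable square_integrable_demand)
  have le: "ext_expectation M (\<lambda>w. total_profit r h \<pi> (\<lambda>i. D i w) (\<lambda>i l. \<xi> i l w) x N)
      \<le> ereal (r * (?b + real N * ?\<mu>))" for N
  proof -
    have intS: "integrable M (\<lambda>w. \<Sum>i = 1..N. real (D i w))"
      using int by (intro Bochner_Integration.integrable_sum) auto
    have "expectation (\<lambda>w. r * (?b + (\<Sum>i = 1..N. real (D i w)))) = r * (?b + (\<Sum>i = 1..N. expectation (\<lambda>w. real (D i w))))"
    proof -
      have "expectation (\<lambda>w. \<Sum>i = 1..N. real (D i w)) = (\<Sum>i = 1..N. expectation (\<lambda>w. real (D i w)))"
        using int by (intro Bochner_Integration.integral_sum) auto
      then show ?thesis using intS by (simp add: prob_space)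
    qed
    also have "(\<Sum>i = 1..N. expectation (\<lambda>w. real (D i w))) = (\<Sum>i = 1..N. ?\<mu>)"
      by (intro sum.cong refl expectation_demand) auto
    also have "\<dots> = real N * ?\<mu>" by simp
    finally have eq: "expectation (\<lambda>w. r * (?b + (\<Sum>i = 1..N. real (D i w)))) = r * (?b + real N * ?\<mu>)" .
    have "ext_expectation M (\<lambda>w. total_profit r h \<pi> (\<lambda>i. D i w) (\<lambda>i l. \<xi> i l w) x N)
        \<le> ereal (expectation (\<lambda>w. r * (?b + (\<Sum>i = 1..N. real (D i w)))))"
      using assms intS by (intro ext_expectation_le total_profit_le) (auto intro!: mult_nonneg_nonneg add_nonneg_nonneg sum_nonneg)
    then show ?thesis unfolding eq .
  qed
  have "avg_profit M D \<xi> r h \<pi> x \<le> liminf (\<lambda>N. ereal (r * (?b + real N * ?\<mu>) / real N))"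
    unfolding avg_profit_def
  proof (rule Liminf_mono)
    show "\<forall>\<^sub>F N in sequentially. ext_expectation M (\<lambda>w. total_profit r h \<pi> (\<lambda>i. D i w) (\<lambda>i l. \<xi> i l w) x N)
        / ereal (real N) \<le> ereal (r * (?b + real N * ?\<mu>) / real N)"
      using eventually_gt_at_top[of 0]
    proof eventually_elim
      case (elim N)
      then show ?case using ereal_divide_right_mono[OF le[of N], of "ereal (real N)"] by simp
    qed
  qed
  also have "\<dots> = ereal (r * ?\<mu>)"
  proof (rule lim_imp_Liminf)
    have "(\<lambda>N. r * (?b + real N * ?\<mu>) / real N) \<longlonglongrightarrow> r * ?\<mu>"
      using affine_div_of_nat_tendsto[of "r * ?b" "r * ?\<mu>"] by (simp add: algebra_simps)
    then show "(\<lambda>N. ereal (r * (?b + real N * ?\<mu>) / real N)) \<longlonglongrightarrow> ereal (r * ?\<mu>)" by simp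
  qed simp
  finally show ?thesis .
qed

lemma avg_profit_base_stock_ge:
  assumes "pipeline_length x > 0" and "h \<ge> 0" and "\<epsilon> > 0"
    and "(\<integral>w. real (D 1 w) \<partial>M) > 0"
  obtains s A where "\<And>r. r \<ge> 0 \<Longrightarrow>
    ereal (r * ((\<integral>w. real (D 1 w) \<partial>M) - \<epsilon>) - A) \<le> avg_profit M D \<xi> r h (base_stock s) x"
proof -
  let ?\<mu> = "expectation (\<lambda>w. real (D 1 w))"
  let ?\<tau> = "pipeline_length x" and ?b = "fst (snd x)" and ?v = "nat (inventory_position x)"
  define g where "g c r N w = (\<Sum>n = 1..N. r * (real (D n w) - real (unmet_bound ?\<tau> c ?b (path w) n))
       - h * (real ((?\<tau> + 1) * c) + excess_bound ?\<tau> c ?b ?v (path w) n + real (unmet_bound ?\<tau> c ?b (path w) n)))"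
    for c r N w
  obtain c A where int: "\<And>r N. integrable M (g c r N)"
    and E: "\<And>r N. r \<ge> 0 \<Longrightarrow> expectation (g c r N) \<ge> real N * (r * (?\<mu> - \<epsilon>) - A) - (r + 1) * A"
    using base_stock_profit_lower_bound[OF assms(4,3,2), of ?\<tau> ?b ?v] unfolding g_def by blast
  have "ereal (r * (?\<mu> - \<epsilon>) - A) \<le> avg_profit M D \<xi> r h (base_stock ((?\<tau> + 1) * c)) x" if "r \<ge> 0" for r
  proof -
    let ?L = "\<lambda>N. real N * (r * (?\<mu> - \<epsilon>) - A) - (r + 1) * A"
    let ?f = "\<lambda>N w. total_profit r h (base_stock ((?\<tau> + 1) * c)) (\<lambda>i. D i w) (\<lambda>i l. \<xi> i l w) x N"
    have le: "ereal (?L N) \<le> ext_expectation M (?f N)" for N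
    proof -
      have "ereal (?L N) \<le> ereal (expectation (g c r N))" using E that by simp
      also have "\<dots> \<le> ext_expectation M (?f N)"
        unfolding g_def
        by (intro ext_expectation_ge int[unfolded g_def] total_profit_base_stock_ge)
           (use assms that in auto)
      finally show ?thesis .
    qed
    have "ereal (r * (?\<mu> - \<epsilon>) - A) = liminf (\<lambda>N. ereal (?L N / real N))"
    proof (rule lim_imp_Liminf[symmetric])
      have "(\<lambda>N. ?L N / real N) \<longlonglongrightarrow> r * (?\<mu> - \<epsilon>) - A"
        using affine_div_of_nat_tendsto[of "- ((r + 1) * A)" "r * (?\<mu> - \<epsilon>) - A"] by simp
      then show "(\<lambda>N. ereal (?L N / real N)) \<longlonglongrightarrow> ereal (r * (?\<mu> - \<epsilon>) - A)" by simp
    qed simp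
    also have "\<dots> \<le> avg_profit M D \<xi> r h (base_stock ((?\<tau> + 1) * c)) x"
      unfolding avg_profit_def
    proof (rule Liminf_mono)
      show "\<forall>\<^sub>F N in sequentially. ereal (?L N / real N) \<le> ext_expectation M (?f N) / ereal (real N)"
        using eventually_gt_at_top[of 0]
      proof eventually_elim
        case (elim N)
        then show ?case using ereal_divide_right_mono[OF le[of N], of "ereal (real N)"] by simp
      qed
    qed
    finally show ?thesis .
  qed
  then show ?thesis using that by blast
qed

end

section \<open>From the joint independence of demands and marks to i.i.d. demand\<close>

lemma (in prob_space) indep_sets_reindex:
  assumes inj: "inj_on f I" and indep: "indep_sets F (f ` I)"
  shows "indep_sets (\<lambda>i. F (f i)) I"
  unfolding indep_sets_def
proof (intro conjI ballI allI impI)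
  fix i assume "i \<in> I"
  then show "F (f i) \<subseteq> events" using indep by (auto simp: indep_sets_def)
next
  fix J A assume J: "J \<subseteq> I" "J \<noteq> {}" "finite J" and A: "A \<in> (\<Pi> i\<in>J. F (f i))"
  define A' where "A' = A \<circ> inv_into I f"
  have inv: "A' (f j) = A j" if "j \<in> J" for j
    using that J inj by (auto simp: A'_def inv_into_f_f)
  have "inj_on f J" using inj J(1) by (rule inj_on_subset)
  have "prob (\<Inter>k\<in>f ` J. A' k) = (\<Prod>k\<in>f ` J. prob (A' k))"
    using J A inv by (intro indep_setsD[OF indep]) auto
  then show "prob (\<Inter>j\<in>J. A j) = (\<Prod>j\<in>J. prob (A j))"
    using inv by (simp add: prod.reindex[OF \<open>inj_on f J\<close>] image_image)
qed

lemma (in prob_space) indep_vars_reindex: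
  assumes "inj_on f I" and "indep_vars N X (f ` I)"
  shows "indep_vars (\<lambda>i. N (f i)) (\<lambda>i. X (f i)) I"
  using assms indep_sets_reindex[OF assms(1), of "\<lambda>i. {X i -` A \<inter> space M | A. A \<in> sets (N i)}"]
  by (auto simp: indep_vars_def2)

lemma (in prob_space) iid_demandI:
  fixes D :: "nat \<Rightarrow> 'a \<Rightarrow> nat" and \<xi> :: "nat \<Rightarrow> nat \<Rightarrow> 'a \<Rightarrow> bool"
  assumes indep: "indep_vars (\<lambda>_. count_space UNIV)
           (case_sum D (\<lambda>(i, l) w. of_bool (\<xi> i l w)))
           (Inl ` {1..} \<union> Inr ` ({1..} \<times> {1..}))"
    and ident: "\<And>i. i \<ge> 1 \<Longrightarrow> distr M (count_space UNIV) (D i) = distr M (count_space UNIV) (D 1)"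
    and "\<gamma> > 0" "integrable M (\<lambda>w. exp (\<gamma> * real (D 1 w)))"
  shows "iid_demand M D"
proof -
  have indepD: "indep_vars (\<lambda>_. count_space UNIV) D {1..}"
  proof -
    have "indep_vars (\<lambda>_. count_space UNIV) (case_sum D (\<lambda>(i, l) w. of_bool (\<xi> i l w))) (Inl ` {1..})"
      by (rule indep_vars_subset[OF indep]) auto
    from indep_vars_reindex[OF _ this] show ?thesis by simp
  qed
  moreover have "square_integrable M (\<lambda>w. real (D 1 w))"
  proof -
    have "D 1 \<in> measurable M (count_space UNIV)"
      using indepD unfolding indep_vars_def2 by auto
    then have m: "(\<lambda>w. real (D 1 w)) \<in> borel_measurable M"
      by (rule measurable_compose) simp
    \<comment> \<open>The quadratic Taylor term of the exponential turns the exponential moment into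
      a second moment.\<close>
    have *: "a\<^sup>2 \<le> 2 / \<gamma>\<^sup>2 * exp (\<gamma> * a)" if "a \<ge> 0" for a :: real
    proof -
      have "(\<gamma> * a)\<^sup>2 / 2 \<le> exp (\<gamma> * a)"
        using exp_lower_Taylor_quadratic[of "\<gamma> * a"] mult_nonneg_nonneg[of \<gamma> a] that \<open>\<gamma> > 0\<close> by linarith
      then show ?thesis using \<open>\<gamma> > 0\<close> by (simp add: field_simps power_mult_distrib)
    qed
    have "integrable M (\<lambda>w. (real (D 1 w))\<^sup>2)"
      by (rule Bochner_Integration.integrable_bound[where f = "\<lambda>w. 2 / \<gamma>\<^sup>2 * exp (\<gamma> * real (D 1 w))"])
         (use assms(4) m * in auto)
    then show ?thesis using m by (simp add: square_integrable_def)
  qed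
  ultimately show ?thesis
    using ident by (unfold_locales)
qed

section \<open>Limit of the profit ratio\<close>

theorem theorem2:
  fixes M :: "'w measure"
    and D :: "nat \<Rightarrow> 'w \<Rightarrow> nat"
    and \<xi> :: "nat \<Rightarrow> nat \<Rightarrow> 'w \<Rightarrow> bool"
    and \<tau> :: nat
    and p h \<gamma> :: real
    and x :: state
  assumes "prob_space M"
    and "\<tau> \<ge> 1"
    and "0 \<le> p" and "p \<le> 1"
    and "h > 0"
    and "prob_space.indep_vars M (\<lambda>_. count_space UNIV)
           (case_sum D (\<lambda>(i, l) w. of_bool (\<xi> i l w)))
           (Inl ` {1..} \<union> Inr ` ({1..} \<times> {1..}))"
    and "\<And>i. i \<ge> 1 \<Longrightarrow> distr M (count_space UNIV) (D i) = distr M (count_space UNIV) (D 1)"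
    and "\<And>i l. i \<ge> 1 \<Longrightarrow> l \<ge> 1 \<Longrightarrow>
           distr M (count_space UNIV) (\<xi> i l) = measure_pmf (bernoulli_pmf p)"
    and "integrable M (\<lambda>w. real (D 1 w))"
    and "(\<integral>w. real (D 1 w) \<partial>M) > 0"
    and "\<gamma> > 0" and "integrable M (\<lambda>w. exp (\<gamma> * real (D 1 w)))"
    and "valid_state \<tau> x"
  shows "((\<lambda>r. (SUP s. avg_profit M D \<xi> r h (base_stock s) x) /
               (SUP \<pi>. avg_profit M D \<xi> r h \<pi> x)) \<longlongrightarrow> 1) at_top"
proof -
  have iid: "iid_demand M D"
    by (rule prob_space.iid_demandI[OF assms(1,6,7,11,12)])
  have len: "pipeline_length x > 0"
    using assms(2,13) by (auto simp: valid_state_def pipeline_length_def split: prod.splits)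
  let ?\<mu> = "\<integral>w. real (D 1 w) \<partial>M"
  let ?S = "\<lambda>r. SUP s. avg_profit M D \<xi> r h (base_stock s) x"
  let ?P = "\<lambda>r. SUP \<pi>. avg_profit M D \<xi> r h \<pi> x"
  have SP: "?S r \<le> ?P r" for r
    by (rule SUP_least) (rule SUP_upper, simp)
  have P: "?P r \<le> ereal (r * ?\<mu>)" if "r \<ge> 0" for r
    using iid_demand.avg_profit_le[OF iid that] assms(5) by (intro SUP_least) simp
  have ratio: "\<forall>\<^sub>F r in at_top. ereal t < ?S r / ?P r \<and> ?S r / ?P r \<le> 1" if t: "0 \<le> t" "t < 1" for t
  proof -
    \<comment> \<open>Half of the gap \<open>?\<mu> * (1 - t)\<close> is spent on unmet demand; the
      other half outweighs the cost \<open>A\<close> once \<open>r * \<epsilon> > A\<close>.\<close>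
    define \<epsilon> where "\<epsilon> = ?\<mu> * (1 - t) / 2"
    have "\<epsilon> > 0" using t assms(10) by (simp add: \<epsilon>_def)
    obtain s A where A: "\<And>r. r \<ge> 0 \<Longrightarrow> ereal (r * (?\<mu> - \<epsilon>) - A) \<le> avg_profit M D \<xi> r h (base_stock s) x"
      using iid_demand.avg_profit_base_stock_ge[OF iid len _ \<open>\<epsilon> > 0\<close> assms(10)] assms(5) by (metis less_imp_le)
    have "\<forall>\<^sub>F r in at_top. r > max 0 (A / \<epsilon>)" by (rule eventually_gt_at_top)
    then show ?thesis
    proof eventually_elim
      case (elim r)
      then have r: "r > 0" "r * \<epsilon> > A" using \<open>\<epsilon> > 0\<close> by (auto simp: field_simps)
      have lower: "ereal (r * (?\<mu> - \<epsilon>) - A) \<le> ?S r"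
        using A[of r] r by (intro SUP_upper2[of s]) auto
      have upper: "?P r \<le> ereal (r * ?\<mu>)" using P r by simp
      \<comment> \<open>Both suprema are finite, so the extended quotient is a quotient of reals;
        its denominator is positive because \<open>0 < a \<le> q\<close>.\<close>
      obtain a where a: "?S r = ereal a"
        using lower SP[of r] upper by (cases "?S r") auto
      obtain q where q: "?P r = ereal q"
        using SP[of r] upper a by (cases "?P r") auto
      have "r * ?\<mu> - 2 * (r * \<epsilon>) = t * (r * ?\<mu>)"
        by (simp add: \<epsilon>_def field_simps)
      moreover have "a \<le> q" "q \<le> r * ?\<mu>" "r * (?\<mu> - \<epsilon>) - A \<le> a"
        using SP[of r] upper lower a q by simp_all
      moreover have "t * (r * ?\<mu>) \<ge> t * q"
        using t \<open>q \<le> r * ?\<mu>\<close> by (intro mult_left_mono)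
      moreover have "t * (r * ?\<mu>) \<ge> 0" using t r assms(10) by simp
      ultimately have "a > t * q" "a > 0" "a \<le> q"
        using r by (simp_all add: right_diff_distrib)
      then show ?case by (simp add: a q field_simps)
    qed
  qed
  show ?thesis
  proof (rule order_tendstoI)
    fix a :: ereal assume "a < 1"
    then have "max a 0 < 1" by simp
    then obtain t where "max a 0 < ereal t" "ereal t < 1" using ereal_dense2 by blast
    then have "\<forall>\<^sub>F r in at_top. ereal t < ?S r / ?P r \<and> ?S r / ?P r \<le> 1" and "a < ereal t"
      by (auto intro!: ratio)
    then show "\<forall>\<^sub>F r in at_top. a < ?S r / ?P r"
      by (auto elim!: eventually_mono intro: less_trans)
  next
    fix a :: ereal assume "a > 1"
    then show "\<forall>\<^sub>F r in at_top. ?S r / ?P r < a"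
      using ratio[of 0] by (auto elim!: eventually_mono)
  qed
qed

end
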